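(* Let $M$ be a monoid and $\alpha$ a strong partial action of $M$ on a semigroup $X$. If the rewriting system $(X_M^+,\to)$ associated with $\alpha$ is locally confluent, then $\alpha$ is globalizable (in the category of semigroups).
   Context: Let $M$ be a monoid with identity $e$. A strong partial action of $M$ on a set $X$ is a family $\alpha=\{\alpha_m:\operatorname{dom}\alpha_m\to X\}_{m\in M}$ of maps with $\operatorname{dom}\alpha_m\subseteq X$ such that: (1) $\operatorname{dom}\alpha_e=X$ and $\alpha_e=\mathrm{id}_X$; (2) $\alpha_m^{-1}(\operatorname{dom}\alpha_n)=\operatorname{dom}\alpha_{nm}\cap\operatorname{dom}\alpha_m$ for all $m,n\in M$; (3) $\alpha_n\circ\alpha_m=\alpha_{nm}$ on $\alpha_m^{-1}(\operatorname{dom}\alpha_n)$ for all $m,n\in M$. It is a global action if $\operatorname{dom}\alpha_m=X$ for all $m$. A strong partial action (global action) of $M$ on a semigroup $X$ is one on the underlying set such that each $\operatorname{dom}\alpha_m$ is a (possibly empty) subsemigroup of $X$ and each $\alpha_m$ is a semigroup homomorphism. If $\alpha$ is a strong partial action of $M$ on a semigroup $X$ and $\beta$ is a global action of $M$ on a semigroup $Y$, a morphism $\iota:\alpha\to\beta$ is a semigroup homomorphism $\iota:X\to Y$ with $\beta_m(\iota(x))=\iota(\alpha_m(x))$ for all $m\in M$, $x\in\operatorname{dom}\alpha_m$. A globalization of $\alpha$ is a pair $(\beta,\iota)$, with $\beta$ a global action of $M$ on a semigroup and $\iota:\alpha\to\beta$ a morphism, such that for all $x,y\in X$ and $m\in M$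 with $\beta_m(\iota(x))=\iota(y)$ one has $x\in\operatorname{dom}\alpha_m$ and $\alpha_m(x)=y$. $\alpha$ is globalizable if it has a globalization. $X_M=(M\times X)/{\approx}$, where $\approx$ is the equivalence relation generated by: $(m,x)\rightharpoonup(n,y)$ iff there is $k\in M$ with $m=nk$, $x\in\operatorname{dom}\alpha_k$ and $y=\alpha_k(x)$. The class of $(m,x)$ is $[m,x]$. $X_M^+$ is the free semigroup on $X_M$ (nonempty words), $X_M^*$ the free monoid. The relation $\to$ on $X_M^+$ is: $u[m,x][m,y]v\to u[m,xy]v$ for all $u,v\in X_M^*$, $m\in M$, $x,y\in X$. $\overset{*}{\to}$ is the reflexive transitive closure of $\to$. A word $w$ is locally confluent if whenever $w\to w_1$ and $w\to w_2$ there is $w'$ with $w_1\overset{*}{\to}w'$ and $w_2\overset{*}{\to}w'$; $(X_M^+,\to)$ is locally confluent if every word is. *)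

theory Defs
  imports "HOL-Algebra.Group"
begin

subsection \<open>Semigroups\<close>

text \<open>
  Semigroups are carried by HOL-Algebra's \<^type>\<open>monoid_scheme\<close> records, so that \<^const>\<open>hom\<close> can be
  used; the field \<^const>\<open>one\<close> is junk for a semigroup and never mentioned. The carrier is
  allowed to be empty.
\<close>

locale semigrp =
  fixes S (structure)
  assumes m_closed: "\<lbrakk>x \<in> carrier S; y \<in> carrier S\<rbrakk> \<Longrightarrow> x \<otimes> y \<in> carrier S"
    and m_assoc: "\<lbrakk>x \<in> carrier S; y \<in> carrier S; z \<in> carrier S\<rbrakk> \<Longrightarrow>
      (x \<otimes> y) \<otimes> z = x \<otimes> (y \<otimes> z)"

definition subsemigrp :: "'a set \<Rightarrow> ('a, 'b) monoid_scheme \<Rightarrow> bool" where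
  "subsemigrp H S \<longleftrightarrow> H \<subseteq> carrier S \<and> (\<forall>x\<in>H. \<forall>y\<in>H. x \<otimes>\<^bsub>S\<^esub> y \<in> H)"

subsection \<open>Strong partial actions\<close>

text \<open>
  The partial map of \<open>m\<close> is \<open>\<alpha> m :: 'x \<rightharpoonup> 'x\<close>. Note that \<open>dom (g \<circ>\<^sub>m f)\<close> is the preimage of
  \<open>dom g\<close> under \<open>f\<close>. Values of \<open>\<alpha>\<close> at elements outside \<open>carrier M\<close> are irrelevant.
\<close>

definition strong_partial_action ::
    "('m, 'k) monoid_scheme \<Rightarrow> 'x set \<Rightarrow> ('m \<Rightarrow> 'x \<rightharpoonup> 'x) \<Rightarrow> bool" where
  "strong_partial_action M A \<alpha> \<longleftrightarrow>
    (\<forall>m\<in>carrier M. dom (\<alpha> m) \<subseteq> A \<and> ran (\<alpha> m) \<subseteq> A) \<and>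
    dom (\<alpha> \<one>\<^bsub>M\<^esub>) = A \<and> (\<forall>x\<in>A. \<alpha> \<one>\<^bsub>M\<^esub> x = Some x) \<and>
    (\<forall>m\<in>carrier M. \<forall>n\<in>carrier M.
       dom (\<alpha> n \<circ>\<^sub>m \<alpha> m) = dom (\<alpha> (n \<otimes>\<^bsub>M\<^esub> m)) \<inter> dom (\<alpha> m)) \<and>
    (\<forall>m\<in>carrier M. \<forall>n\<in>carrier M. \<forall>x\<in>dom (\<alpha> n \<circ>\<^sub>m \<alpha> m).
       (\<alpha> n \<circ>\<^sub>m \<alpha> m) x = \<alpha> (n \<otimes>\<^bsub>M\<^esub> m) x)"

definition strong_partial_action_semigrp ::
    "('m, 'k) monoid_scheme \<Rightarrow> ('x, 'l) monoid_scheme \<Rightarrow> ('m \<Rightarrow> 'x \<rightharpoonup> 'x) \<Rightarrow> bool" where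
  "strong_partial_action_semigrp M X \<alpha> \<longleftrightarrow>
    strong_partial_action M (carrier X) \<alpha> \<and>
    (\<forall>m\<in>carrier M. subsemigrp (dom (\<alpha> m)) X \<and>
       (\<lambda>x. the (\<alpha> m x)) \<in> hom (X\<lparr>carrier := dom (\<alpha> m)\<rparr>) X)"

definition global_action_semigrp ::
    "('m, 'k) monoid_scheme \<Rightarrow> ('y, 'l) monoid_scheme \<Rightarrow> ('m \<Rightarrow> 'y \<rightharpoonup> 'y) \<Rightarrow> bool" where
  "global_action_semigrp M Y \<beta> \<longleftrightarrow>
    strong_partial_action_semigrp M Y \<beta> \<and> (\<forall>m\<in>carrier M. dom (\<beta> m) = carrier Y)"

subsection \<open>Globalizations\<close>

definition action_morphism ::
    "('m, 'k) monoid_scheme \<Rightarrow> ('x, 'l) monoid_scheme \<Rightarrow> ('m \<Rightarrow> 'x \<rightharpoonup> 'x) \<Rightarrow>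
      ('y, 'n) monoid_scheme \<Rightarrow> ('m \<Rightarrow> 'y \<rightharpoonup> 'y) \<Rightarrow> ('x \<Rightarrow> 'y) \<Rightarrow> bool" where
  "action_morphism M X \<alpha> Y \<beta> \<iota> \<longleftrightarrow> \<iota> \<in> hom X Y \<and>
    (\<forall>m\<in>carrier M. \<forall>x\<in>dom (\<alpha> m). \<beta> m (\<iota> x) = Some (\<iota> (the (\<alpha> m x))))"

definition globalization ::
    "('m, 'k) monoid_scheme \<Rightarrow> ('x, 'l) monoid_scheme \<Rightarrow> ('m \<Rightarrow> 'x \<rightharpoonup> 'x) \<Rightarrow>
      ('y, 'n) monoid_scheme \<Rightarrow> ('m \<Rightarrow> 'y \<rightharpoonup> 'y) \<Rightarrow> ('x \<Rightarrow> 'y) \<Rightarrow> bool" where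
  "globalization M X \<alpha> Y \<beta> \<iota> \<longleftrightarrow>
    semigrp Y \<and> global_action_semigrp M Y \<beta> \<and> action_morphism M X \<alpha> Y \<beta> \<iota> \<and>
    (\<forall>x\<in>carrier X. \<forall>y\<in>carrier X. \<forall>m\<in>carrier M.
       \<beta> m (\<iota> x) = Some (\<iota> y) \<longrightarrow> x \<in> dom (\<alpha> m) \<and> \<alpha> m x = Some y)"

text \<open>
  HOL cannot quantify existentially over types, so the semigroup of the globalization is
  sought on the type of sets of words over sets of pairs, where the quotients of the free
  semigroup on the classes \<open>[m, x]\<close> live. This loses nothing: by \<open>globalizable_if_globalization\<close>
  below, a globalization on any type whatsoever yields one on this type.
\<close>

definition globalizable ::
    "('m, 'k) monoid_scheme \<Rightarrow> ('x, 'l) monoid_scheme \<Rightarrow> ('m \<Rightarrow> 'x \<rightharpoonup> 'x) \<Rightarrow> bool" where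
  "globalizable M X \<alpha> \<longleftrightarrow>
    (\<exists>(Y :: ('m \<times> 'x) set list set monoid) \<beta> \<iota>. globalization M X \<alpha> Y \<beta> \<iota>)"

subsection \<open>The rewriting system of a partial action\<close>

text \<open>
  \<open>tensor_step\<close> generates the equivalence \<open>\<approx>\<close> on \<open>M \<times> X\<close>, here \<open>tensor_rel\<close>; \<open>tensor_class m x\<close> is
  \<open>[m, x]\<close> and \<open>tensor_set\<close> is \<open>X\<^sub>M\<close>. Intersecting \<^const>\<open>equivclp\<close> with \<open>M \<times> X\<close> only drops
  reflexivity at pairs outside it.
\<close>

definition tensor_step ::
    "('m, 'k) monoid_scheme \<Rightarrow> ('x, 'l) monoid_scheme \<Rightarrow> ('m \<Rightarrow> 'x \<rightharpoonup> 'x) \<Rightarrow>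
      'm \<times> 'x \<Rightarrow> 'm \<times> 'x \<Rightarrow> bool" where
  "tensor_step M X \<alpha> = (\<lambda>(m, x) (n, y).
    m \<in> carrier M \<and> x \<in> carrier X \<and> n \<in> carrier M \<and> y \<in> carrier X \<and>
    (\<exists>k\<in>carrier M. m = n \<otimes>\<^bsub>M\<^esub> k \<and> x \<in> dom (\<alpha> k) \<and> \<alpha> k x = Some y))"

definition tensor_rel ::
    "('m, 'k) monoid_scheme \<Rightarrow> ('x, 'l) monoid_scheme \<Rightarrow> ('m \<Rightarrow> 'x \<rightharpoonup> 'x) \<Rightarrow>
      (('m \<times> 'x) \<times> ('m \<times> 'x)) set" where
  "tensor_rel M X \<alpha> =
    {(p, q). p \<in> carrier M \<times> carrier X \<and> q \<in> carrier M \<times> carrier X \<and>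
       equivclp (tensor_step M X \<alpha>) p q}"

definition tensor_class ::
    "('m, 'k) monoid_scheme \<Rightarrow> ('x, 'l) monoid_scheme \<Rightarrow> ('m \<Rightarrow> 'x \<rightharpoonup> 'x) \<Rightarrow>
      'm \<Rightarrow> 'x \<Rightarrow> ('m \<times> 'x) set" where
  "tensor_class M X \<alpha> m x = tensor_rel M X \<alpha> `` {(m, x)}"

definition tensor_set ::
    "('m, 'k) monoid_scheme \<Rightarrow> ('x, 'l) monoid_scheme \<Rightarrow> ('m \<Rightarrow> 'x \<rightharpoonup> 'x) \<Rightarrow>
      ('m \<times> 'x) set set" where
  "tensor_set M X \<alpha> = (carrier M \<times> carrier X) // tensor_rel M X \<alpha>"

definition tensor_words ::
    "('m, 'k) monoid_scheme \<Rightarrow> ('x, 'l) monoid_scheme \<Rightarrow> ('m \<Rightarrow> 'x \<rightharpoonup> 'x) \<Rightarrow>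
      ('m \<times> 'x) set list set" where
  "tensor_words M X \<alpha> = lists (tensor_set M X \<alpha>) - {[]}"

definition word_step ::
    "('m, 'k) monoid_scheme \<Rightarrow> ('x, 'l) monoid_scheme \<Rightarrow> ('m \<Rightarrow> 'x \<rightharpoonup> 'x) \<Rightarrow>
      ('m \<times> 'x) set list \<Rightarrow> ('m \<times> 'x) set list \<Rightarrow> bool" where
  "word_step M X \<alpha> w w' \<longleftrightarrow>
    (\<exists>u\<in>lists (tensor_set M X \<alpha>). \<exists>v\<in>lists (tensor_set M X \<alpha>).
     \<exists>m\<in>carrier M. \<exists>x\<in>carrier X. \<exists>y\<in>carrier X.
       w = u @ [tensor_class M X \<alpha> m x, tensor_class M X \<alpha> m y] @ v \<and>
       w' = u @ [tensor_class M X \<alpha> m (x \<otimes>\<^bsub>X\<^esub> y)] @ v)"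

definition locally_confluent_at :: "('w \<Rightarrow> 'w \<Rightarrow> bool) \<Rightarrow> 'w \<Rightarrow> bool" where
  "locally_confluent_at r w \<longleftrightarrow>
    (\<forall>w1 w2. r w w1 \<and> r w w2 \<longrightarrow> (\<exists>w'. r\<^sup>*\<^sup>* w1 w' \<and> r\<^sup>*\<^sup>* w2 w'))"

definition locally_confluent_on :: "'w set \<Rightarrow> ('w \<Rightarrow> 'w \<Rightarrow> bool) \<Rightarrow> bool" where
  "locally_confluent_on W r \<longleftrightarrow> (\<forall>w\<in>W. locally_confluent_at r w)"

subsection \<open>Independence of the type carrying a globalization\<close>

text \<open>
  The subsemigroup generated by the elements \<open>\<beta> m (\<iota> x)\<close> is invariant under \<open>\<beta>\<close>; an element of
  it is encoded by the set of all nonempty words in \<open>M \<times> X\<close> that evaluate to it.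
\<close>

fun word_eval :: "('y \<Rightarrow> 'y \<Rightarrow> 'y) \<Rightarrow> ('p \<Rightarrow> 'y) \<Rightarrow> 'p list \<Rightarrow> 'y" where
  "word_eval f h [] = undefined"
| "word_eval f h [p] = h p"
| "word_eval f h (p # q # r) = f (h p) (word_eval f h (q # r))"

lemma word_eval_Cons: "w \<noteq> [] \<Longrightarrow> word_eval f h (p # w) = f (h p) (word_eval f h w)"
  by (cases w) auto

lemma word_eval_closed:
  assumes "semigrp Y" "h ` A \<subseteq> carrier Y" "w \<in> lists A" "w \<noteq> []"
  shows "word_eval (mult Y) h w \<in> carrier Y"
  using assms(3,4)
proof (induction w rule: list.induct)
  case (Cons p w)
  then show ?case using assms(1,2)
    by (cases "w = []") (auto simp: word_eval_Cons semigrp_def)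
qed simp

lemma word_eval_append:
  assumes "semigrp Y" "h ` A \<subseteq> carrier Y" "w \<in> lists A" "w \<noteq> []" "v \<in> lists A" "v \<noteq> []"
  shows "word_eval (mult Y) h (w @ v) = word_eval (mult Y) h w \<otimes>\<^bsub>Y\<^esub> word_eval (mult Y) h v"
  using assms(3,4)
proof (induction w rule: list.induct)
  case (Cons p w)
  show ?case
  proof (cases "w = []")
    case True
    then show ?thesis using assms(6) by (simp add: word_eval_Cons)
  next
    case False
    have "h p \<in> carrier Y" using Cons.prems(1) assms(2) by (simp add: image_subset_iff)
    moreover have "word_eval (mult Y) h w \<in> carrier Y" "word_eval (mult Y) h v \<in> carrier Y"
      using word_eval_closed[OF assms(1,2)] Cons.prems False assms(5,6) by auto
    ultimately show ?thesis
      using Cons False semigrp.m_assoc[OF assms(1)] by (simp add: word_eval_Cons)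
  qed
qed simp

lemma globalizable_if_globalization:
  fixes M :: "('m, 'k) monoid_scheme" and X :: "('x, 'l) monoid_scheme"
    and Y :: "('y, 'n) monoid_scheme"
  assumes M: "monoid M" and pX: "strong_partial_action_semigrp M X \<alpha>"
    and gl: "globalization M X \<alpha> Y \<beta> \<iota>"
  shows "globalizable M X \<alpha>"
proof -
  interpret M: monoid M by (rule M)
  have Y: "semigrp Y" and ga: "global_action_semigrp M Y \<beta>" and mor: "action_morphism M X \<alpha> Y \<beta> \<iota>"
    and refl: "\<And>x y m. \<lbrakk>x \<in> carrier X; y \<in> carrier X; m \<in> carrier M; \<beta> m (\<iota> x) = Some (\<iota> y)\<rbrakk>
      \<Longrightarrow> x \<in> dom (\<alpha> m) \<and> \<alpha> m x = Some y"
    using gl unfolding globalization_def by blast+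
  interpret Y: semigrp Y by (rule Y)
  have "strong_partial_action M (carrier X) \<alpha>"
    using pX unfolding strong_partial_action_semigrp_def by (rule conjunct1)
  then have aX: "dom (\<alpha> m) \<subseteq> carrier X" if "m \<in> carrier M" for m
    using that unfolding strong_partial_action_def by (elim conjE) simp
  define b where "b m y = the (\<beta> m y)" for m y
  have b_some: "\<beta> m y = Some (b m y)" if "m \<in> carrier M" "y \<in> carrier Y" for m y
  proof -
    have "y \<in> dom (\<beta> m)" using ga that unfolding global_action_semigrp_def by blast
    then show ?thesis by (auto simp: b_def)
  qed
  have b_closed: "b m y \<in> carrier Y" if "m \<in> carrier M" "y \<in> carrier Y" for m y
    using ga that b_some[OF that]
    unfolding global_action_semigrp_def strong_partial_action_semigrp_def strong_partial_action_def
    by (meson ranI subsetD)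
  have b_one: "b \<one>\<^bsub>M\<^esub> y = y" if "y \<in> carrier Y" for y
    using ga that
    unfolding global_action_semigrp_def strong_partial_action_semigrp_def strong_partial_action_def
      b_def by simp
  have b_mult: "b m (y \<otimes>\<^bsub>Y\<^esub> z) = b m y \<otimes>\<^bsub>Y\<^esub> b m z"
    if "m \<in> carrier M" "y \<in> carrier Y" "z \<in> carrier Y" for m y z
    using ga that unfolding global_action_semigrp_def strong_partial_action_semigrp_def b_def hom_def
    by auto
  have b_comp: "b n (b m y) = b (n \<otimes>\<^bsub>M\<^esub> m) y"
    if "m \<in> carrier M" "n \<in> carrier M" "y \<in> carrier Y" for m n y
  proof -
    have e: "(\<beta> n \<circ>\<^sub>m \<beta> m) y = Some (b n (b m y))"
      using that b_some b_closed by (simp add: map_comp_def)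
    then have "y \<in> dom (\<beta> n \<circ>\<^sub>m \<beta> m)" by blast
    then have "(\<beta> n \<circ>\<^sub>m \<beta> m) y = \<beta> (n \<otimes>\<^bsub>M\<^esub> m) y"
      using ga that unfolding global_action_semigrp_def strong_partial_action_semigrp_def
        strong_partial_action_def by blast
    then show ?thesis using e by (metis b_def option.sel)
  qed
  have i_closed: "\<iota> x \<in> carrier Y" if "x \<in> carrier X" for x
    using mor that unfolding action_morphism_def hom_def by auto
  have i_mult: "\<iota> (x \<otimes>\<^bsub>X\<^esub> y) = \<iota> x \<otimes>\<^bsub>Y\<^esub> \<iota> y" if "x \<in> carrier X" "y \<in> carrier X" for x y
    using mor that unfolding action_morphism_def hom_def by auto

  define A where "A = carrier M \<times> carrier X"
  define h where "h = (\<lambda>(m, x). b m (\<iota> x))"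
  define ev where "ev = word_eval (mult Y) h"
  define T where "T = ev ` (lists A - {[]})"
  have hA: "h ` A \<subseteq> carrier Y" by (auto simp: A_def h_def b_closed i_closed)
  have T_Y: "y \<in> carrier Y" if "y \<in> T" for y
    using that word_eval_closed[OF Y hA] by (auto simp: T_def ev_def)
  have T_mult: "y \<otimes>\<^bsub>Y\<^esub> z \<in> T" if yz: "y \<in> T" "z \<in> T" for y z
  proof -
    obtain u v where "u \<in> lists A - {[]}" "v \<in> lists A - {[]}" "y = ev u" "z = ev v"
      using yz unfolding T_def by blast
    then have "y \<otimes>\<^bsub>Y\<^esub> z = ev (u @ v)" "u @ v \<in> lists A - {[]}"
      using word_eval_append[OF Y hA] by (auto simp: ev_def)
    then show ?thesis unfolding T_def by blast
  qed
  have ev_b: "b n (ev w) \<in> T" if "n \<in> carrier M" "w \<in> lists A" "w \<noteq> []" for n w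
    using that(2,3)
  proof (induction w rule: list.induct)
    case (Cons p w)
    obtain m x where p: "p = (m, x)" "m \<in> carrier M" "x \<in> carrier X"
      using Cons.prems by (auto simp: A_def)
    have "b n (h p) = ev [(n \<otimes>\<^bsub>M\<^esub> m, x)]"
      using p that(1) b_comp i_closed by (simp add: h_def ev_def)
    moreover have "[(n \<otimes>\<^bsub>M\<^esub> m, x)] \<in> lists A - {[]}" using p that(1) by (simp add: A_def)
    ultimately have hp: "b n (h p) \<in> T" unfolding T_def by blast
    show ?case
    proof (cases "w = []")
      case True
      then show ?thesis using hp by (simp add: ev_def)
    next
      case False
      have "b n (ev (p # w)) = b n (h p) \<otimes>\<^bsub>Y\<^esub> b n (ev w)"
        using Cons.prems False that(1) hA word_eval_closed[OF Y hA, of w]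
        by (auto simp: ev_def word_eval_Cons intro!: b_mult)
      then show ?thesis using T_mult hp Cons False by auto
    qed
  qed simp
  have T_b: "b n y \<in> T" if "n \<in> carrier M" "y \<in> T" for n y
    using that(2) ev_b[OF that(1)] unfolding T_def by auto
  have T_i: "\<iota> x \<in> T" if "x \<in> carrier X" for x
  proof -
    have "\<iota> x = ev [(\<one>\<^bsub>M\<^esub>, x)]" using that b_one i_closed by (simp add: ev_def h_def)
    moreover have "[(\<one>\<^bsub>M\<^esub>, x)] \<in> lists A - {[]}" using that by (simp add: A_def)
    ultimately show ?thesis unfolding T_def by blast
  qed

  define c :: "'y \<Rightarrow> ('m \<times> 'x) set list set"
    where "c y = {map (\<lambda>p. {p}) w | w. w \<in> lists A - {[]} \<and> ev w = y}" for y
  have c_inj: "inj_on c T"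
  proof (rule inj_onI)
    fix y z assume "y \<in> T" "z \<in> T" "c y = c z"
    then obtain w where w: "w \<in> lists A - {[]}" "ev w = y" unfolding T_def by blast
    then have "map (\<lambda>p. {p}) w \<in> c y" unfolding c_def by blast
    then have "map (\<lambda>p. {p}) w \<in> c z" using \<open>c y = c z\<close> by simp
    then obtain v where v: "map (\<lambda>p. {p}) w = map (\<lambda>p. {p}) v" "ev v = z" unfolding c_def by blast
    have "inj (\<lambda>p. {p})" by (simp add: inj_def)
    then have "w = v" using v(1) by (simp add: inj_map_eq_map)
    then show "y = z" using w v by simp
  qed
  define d where "d = inv_into T c"
  have dc: "d (c y) = y" if "y \<in> T" for y using c_inj that by (simp add: d_def)
  define Z :: "('m \<times> 'x) set list set monoid"
    where "Z = \<lparr>carrier = c ` T, mult = (\<lambda>p q. c (d p \<otimes>\<^bsub>Y\<^esub> d q)), one = undefined\<rparr>"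
  define g where "g m z = (if z \<in> c ` T then Some (c (b m (d z))) else None)" for m z
  have Zc: "carrier Z = c ` T" by (simp add: Z_def)
  have Zm: "c y \<otimes>\<^bsub>Z\<^esub> c z = c (y \<otimes>\<^bsub>Y\<^esub> z)" if "y \<in> T" "z \<in> T" for y z
    using that dc by (simp add: Z_def)
  have gc: "g m (c y) = Some (c (b m y))" if "y \<in> T" for m y
    using that dc by (simp add: g_def)
  have dg: "dom (g m) = c ` T" for m by (auto simp: g_def split: if_splits)
  have Z: "semigrp Z"
  proof
    fix x y assume "x \<in> carrier Z" "y \<in> carrier Z"
    then show "x \<otimes>\<^bsub>Z\<^esub> y \<in> carrier Z" using T_mult by (auto simp: Zc Zm)
  next
    fix x y z assume "x \<in> carrier Z" "y \<in> carrier Z" "z \<in> carrier Z"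
    then show "(x \<otimes>\<^bsub>Z\<^esub> y) \<otimes>\<^bsub>Z\<^esub> z = x \<otimes>\<^bsub>Z\<^esub> (y \<otimes>\<^bsub>Z\<^esub> z)"
      using T_mult T_Y Y.m_assoc by (auto simp: Zc Zm)
  qed
  have comp: "(g n \<circ>\<^sub>m g m) (c y) = g (n \<otimes>\<^bsub>M\<^esub> m) (c y)"
    if "m \<in> carrier M" "n \<in> carrier M" "y \<in> T" for m n y
    using that gc T_b T_Y b_comp by (simp add: map_comp_def)
  have dcomp: "dom (g n \<circ>\<^sub>m g m) = c ` T" if "m \<in> carrier M" "n \<in> carrier M" for m n
  proof
    show "dom (g n \<circ>\<^sub>m g m) \<subseteq> c ` T"
      unfolding dg[of m, symmetric] by (auto simp: map_comp_def split: option.splits)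
    show "c ` T \<subseteq> dom (g n \<circ>\<^sub>m g m)"
    proof
      fix z assume "z \<in> c ` T"
      then obtain y where y: "y \<in> T" "z = c y" by blast
      then have "(g n \<circ>\<^sub>m g m) z = Some (c (b (n \<otimes>\<^bsub>M\<^esub> m) y))"
        using that comp gc by simp
      then show "z \<in> dom (g n \<circ>\<^sub>m g m)" by blast
    qed
  qed
  have pa: "strong_partial_action M (carrier Z) g"
    unfolding strong_partial_action_def Zc
  proof (intro conjI ballI)
    fix m assume m: "m \<in> carrier M"
    show "ran (g m) \<subseteq> c ` T"
    proof
      fix z assume "z \<in> ran (g m)"
      then obtain p where p: "g m p = Some z" by (auto simp: ran_def)
      then obtain y where "y \<in> T" "p = c y" by (auto simp: g_def split: if_splits)
      then show "z \<in> c ` T" using p gc[of y m] T_b[OF m, of y] by auto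
    qed
  next
    fix z assume "z \<in> c ` T"
    then show "g \<one>\<^bsub>M\<^esub> z = Some z" using gc b_one T_Y by auto
  next
    fix m n x assume *: "m \<in> carrier M" "n \<in> carrier M" "x \<in> dom (g n \<circ>\<^sub>m g m)"
    then obtain y where "y \<in> T" "x = c y" using dcomp by blast
    then show "(g n \<circ>\<^sub>m g m) x = g (n \<otimes>\<^bsub>M\<^esub> m) x" using comp * by blast
  qed (simp_all add: dg dcomp)
  have pas: "strong_partial_action_semigrp M Z g"
    unfolding strong_partial_action_semigrp_def
  proof (intro conjI ballI pa)
    fix m assume m: "m \<in> carrier M"
    have mult: "p \<otimes>\<^bsub>Z\<^esub> q \<in> c ` T" if "p \<in> c ` T" "q \<in> c ` T" for p q
      using that semigrp.m_closed[OF Z] by (simp add: Zc)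
    then show "subsemigrp (dom (g m)) Z"
      unfolding subsemigrp_def dg Zc by blast
    have closed: "the (g m p) \<in> c ` T" if "p \<in> c ` T" for p
    proof -
      obtain y where "y \<in> T" "p = c y" using \<open>p \<in> c ` T\<close> by blast
      then show ?thesis using gc[of y m] T_b[OF m, of y] by simp
    qed
    have hom: "the (g m (p \<otimes>\<^bsub>Z\<^esub> q)) = the (g m p) \<otimes>\<^bsub>Z\<^esub> the (g m q)"
      if pq: "p \<in> c ` T" "q \<in> c ` T" for p q
    proof -
      obtain y z where yz: "y \<in> T" "p = c y" "z \<in> T" "q = c z" using pq by blast
      have "g m (p \<otimes>\<^bsub>Z\<^esub> q) = Some (c (b m (y \<otimes>\<^bsub>Y\<^esub> z)))"
        using yz Zm[of y z] gc[OF T_mult[of y z], of m] by metis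
      moreover have "b m (y \<otimes>\<^bsub>Y\<^esub> z) = b m y \<otimes>\<^bsub>Y\<^esub> b m z"
        using yz by (intro b_mult m T_Y)
      moreover have "c (b m y \<otimes>\<^bsub>Y\<^esub> b m z) = c (b m y) \<otimes>\<^bsub>Z\<^esub> c (b m z)"
        using yz by (intro Zm[symmetric] T_b m)
      ultimately show ?thesis using yz gc[of y m] gc[of z m] by simp
    qed
    show "(\<lambda>x. the (g m x)) \<in> hom (Z\<lparr>carrier := dom (g m)\<rparr>) Z"
      using closed hom unfolding hom_def dg by (simp add: Zc Pi_iff)
  qed
  have "globalization M X \<alpha> Z g (\<lambda>x. c (\<iota> x))"
    unfolding globalization_def global_action_semigrp_def
  proof (intro conjI ballI impI Z pas)
    fix m assume "m \<in> carrier M"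
    show "dom (g m) = carrier Z" by (simp add: dg Zc)
  next
    have "g m (c (\<iota> x)) = Some (c (\<iota> (the (\<alpha> m x))))" if "m \<in> carrier M" "x \<in> dom (\<alpha> m)" for m x
    proof -
      have "x \<in> carrier X"
        using aX[OF that(1)] that(2) by (rule subsetD)
      then have "g m (c (\<iota> x)) = Some (c (b m (\<iota> x)))" using gc T_i by blast
      moreover have "\<beta> m (\<iota> x) = Some (\<iota> (the (\<alpha> m x)))"
        using mor that unfolding action_morphism_def by blast
      then have "b m (\<iota> x) = \<iota> (the (\<alpha> m x))" 
        by (simp only: b_def option.sel)
      ultimately show ?thesis by (simp only:)
    qed
    moreover have "c (\<iota> (x \<otimes>\<^bsub>X\<^esub> y)) = c (\<iota> x) \<otimes>\<^bsub>Z\<^esub> c (\<iota> y)"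
      if "x \<in> carrier X" "y \<in> carrier X" for x y
      using i_mult[OF that] Zm[OF T_i T_i, OF that] by simp
    then have "(\<lambda>x. c (\<iota> x)) \<in> hom X Z"
      using T_i by (simp add: hom_def Zc Pi_iff)
    ultimately show "action_morphism M X \<alpha> Z g (\<lambda>x. c (\<iota> x))"
      unfolding action_morphism_def by blast
  next
    fix x y m
    assume *: "x \<in> carrier X" "y \<in> carrier X" "m \<in> carrier M" "g m (c (\<iota> x)) = Some (c (\<iota> y))"
    then have "c (b m (\<iota> x)) = c (\<iota> y)" using gc[OF T_i, of x m] by simp
    then have "b m (\<iota> x) = \<iota> y"
      using inj_onD[OF c_inj] T_b[OF *(3)] T_i * by blast
    then have "\<beta> m (\<iota> x) = Some (\<iota> y)" using * b_some i_closed by simp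
    then show "x \<in> dom (\<alpha> m)" "\<alpha> m x = Some y" using refl * by blast+
  qed
  then show ?thesis unfolding globalizable_def by blast
qed

end

theory Submission
  imports Defs "HOL-Library.Confluence"
begin

text \<open>
  The globalization is the quotient of \<open>X\<^sub>M\<^sup>+\<close> by the equivalence generated by \<open>\<rightarrow>\<close>, with \<open>k\<close> acting
  letterwise by \<open>[m, x] \<mapsto> [k m, x]\<close> and \<open>\<iota> x = [e, x]\<close>. Rewriting shortens words, so by Newman's
  lemma local confluence makes the system confluent, and equivalent one-letter words, being
  irreducible, are equal. Hence \<open>\<beta> m (\<iota> x) = \<iota> y\<close> says \<open>[m, x] = [e, y]\<close>. Finally the partial value
  \<open>\<alpha> m x\<close> depends only on \<open>[m, x]\<close>, by strength of \<open>\<alpha>\<close>, so that \<open>\<alpha> m x = \<alpha> e y = y\<close>.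
\<close>

subsection \<open>Abstract rewriting\<close>

text \<open>Well-founded induction on the source of the peak. The first steps to \<open>y'\<close>
  and \<open>z'\<close> are joined at \<open>u\<close>. The induction hypothesis at
  \<open>y'\<close> joins \<open>y\<close> and \<open>u\<close> at \<open>v\<close>; at
  \<open>z'\<close>, which reaches \<open>v\<close> through \<open>u\<close>, it joins
  \<open>v\<close> and \<open>z\<close>.\<close>

lemma newman:
  assumes wf: "wfp r\<inverse>\<inverse>" and lc: "\<And>x. locally_confluent_at r x"
  shows "confluentp r"
proof (rule confluentpI)
  fix x y z assume "r\<^sup>*\<^sup>* x y" "r\<^sup>*\<^sup>* x z"
  then show "\<exists>u. r\<^sup>*\<^sup>* y u \<and> r\<^sup>*\<^sup>* z u"
  proof (induction x arbitrary: y z rule: wfp_induct_rule[OF wf])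
    case (1 x)
    show ?case
    proof (cases "x = y \<or> x = z")
      case True
      then show ?thesis using "1.prems" by blast
    next
      case False
      obtain y' z' where y': "r x y'" "r\<^sup>*\<^sup>* y' y" and z': "r x z'" "r\<^sup>*\<^sup>* z' z"
        using "1.prems" False by (metis converse_rtranclpE)
      obtain u where u: "r\<^sup>*\<^sup>* y' u" "r\<^sup>*\<^sup>* z' u"
        using lc y'(1) z'(1) unfolding locally_confluent_at_def by blast
      obtain v where v: "r\<^sup>*\<^sup>* y v" "r\<^sup>*\<^sup>* u v"
        using "1.IH"[of y'] y' u(1) by blast
      obtain w where "r\<^sup>*\<^sup>* v w" "r\<^sup>*\<^sup>* z w"
        using "1.IH"[of z'] z' u(2) v(2) by (meson conversepI rtranclp_trans)
      then show ?thesis using v(1) by (meson rtranclp_trans)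
    qed
  qed
qed

text \<open>Church-Rosser: under confluence equivalent elements have a common reduct, and an
  irreducible element reduces only to itself.\<close>

lemma equivclp_irreducible_eq:
  assumes "confluentp r" "equivclp r x y" "\<And>z. \<not> r x z" "\<And>z. \<not> r y z"
  shows "x = y"
proof -
  have "(r\<^sup>*\<^sup>* OO r\<inverse>\<inverse>\<^sup>*\<^sup>*) x y"
    using assms(1,2) semiconfluentp_equivclp confluentp_imp_semiconfluentp by metis
  then obtain z where "r\<^sup>*\<^sup>* x z" "r\<^sup>*\<^sup>* y z" by (auto simp: rtranclp_conversep)
  then show ?thesis using assms(3,4) by (metis converse_rtranclpE)
qed

text \<open>A map that preserves generating steps descends to classes. It is applied to left
  translation on pairs, to concatenation with a fixed word and to the letterwise action.\<close>

lemma equivclp_map: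
  assumes "\<And>x y. r x y \<Longrightarrow> s (f x) (f y)" "equivclp r x y"
  shows "equivclp s (f x) (f y)"
  using assms(2) by induction (auto intro: equivclp_into_equivclp dest: assms(1))

subsection \<open>Global actions by total maps\<close>

text \<open>For total maps the domain conditions collapse, leaving the laws of a monoid action by
  endomorphisms. Cutting \<open>b\<close> off outside \<open>carrier Y\<close> makes each domain
  exactly the carrier.\<close>

lemma global_action_semigrpI:
  assumes "monoid M" "semigrp Y"
    and closed: "\<And>m y. \<lbrakk>m \<in> carrier M; y \<in> carrier Y\<rbrakk> \<Longrightarrow> b m y \<in> carrier Y"
    and one: "\<And>y. y \<in> carrier Y \<Longrightarrow> b \<one>\<^bsub>M\<^esub> y = y"
    and comp: "\<And>m n y. \<lbrakk>m \<in> carrier M; n \<in> carrier M; y \<in> carrier Y\<rbrakk>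
      \<Longrightarrow> b n (b m y) = b (n \<otimes>\<^bsub>M\<^esub> m) y"
    and mult: "\<And>m y z. \<lbrakk>m \<in> carrier M; y \<in> carrier Y; z \<in> carrier Y\<rbrakk>
      \<Longrightarrow> b m (y \<otimes>\<^bsub>Y\<^esub> z) = b m y \<otimes>\<^bsub>Y\<^esub> b m z"
  shows "global_action_semigrp M Y (\<lambda>m y. if y \<in> carrier Y then Some (b m y) else None)"
    (is "global_action_semigrp M Y ?\<beta>")
proof -
  interpret M: monoid M by fact
  interpret Y: semigrp Y by fact
  have d: "dom (?\<beta> m) = carrier Y" for m by (auto split: if_splits)
  have c: "(?\<beta> n \<circ>\<^sub>m ?\<beta> m) = ?\<beta> (n \<otimes>\<^bsub>M\<^esub> m)" if "m \<in> carrier M" "n \<in> carrier M" for m n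
    using that closed comp by (auto simp: map_comp_def fun_eq_iff)
  have "ran (?\<beta> m) \<subseteq> carrier Y" if "m \<in> carrier M" for m
    using that closed by (auto simp: ran_def)
  then have "strong_partial_action M (carrier Y) ?\<beta>"
    unfolding strong_partial_action_def d using one by (auto simp: c d)
  then show ?thesis
    unfolding global_action_semigrp_def strong_partial_action_semigrp_def d subsemigrp_def hom_def
    by (auto simp: closed mult Y.m_closed)
qed

subsection \<open>The tensor product\<close>

locale semigrp_partial_action = M: monoid M + X: semigrp X
  for M :: "('m, 'k) monoid_scheme" (structure) and X :: "('x, 'l) monoid_scheme" (structure) +
  fixes \<alpha> :: "'m \<Rightarrow> 'x \<rightharpoonup> 'x"
  assumes partial_action: "strong_partial_action_semigrp M X \<alpha>"
begin

lemma strong: "strong_partial_action M (carrier X) \<alpha>"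
  using partial_action unfolding strong_partial_action_semigrp_def by blast

lemma action_closed:
  assumes "m \<in> carrier M" "\<alpha> m x = Some y"
  shows "x \<in> carrier X" "y \<in> carrier X"
proof -
  have "dom (\<alpha> m) \<subseteq> carrier X" "ran (\<alpha> m) \<subseteq> carrier X"
    using strong assms(1) unfolding strong_partial_action_def by (elim conjE; simp)+
  then show "x \<in> carrier X" "y \<in> carrier X"
    using domI[of "\<alpha> m" x] ranI[of "\<alpha> m" x] assms(2) by auto
qed

lemma action_one: "x \<in> carrier X \<Longrightarrow> \<alpha> \<one>\<^bsub>M\<^esub> x = Some x"
  using strong unfolding strong_partial_action_def by blast

text \<open>This also says that one side is defined iff the other one is.\<close>

lemma action_comp:
  assumes "m \<in> carrier M" "n \<in> carrier M" "\<alpha> m x = Some y"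
  shows "\<alpha> (n \<otimes>\<^bsub>M\<^esub> m) x = \<alpha> n y"
proof -
  have e: "(\<alpha> n \<circ>\<^sub>m \<alpha> m) x = \<alpha> n y" using assms(3) by (simp add: map_comp_def)
  have d: "dom (\<alpha> n \<circ>\<^sub>m \<alpha> m) = dom (\<alpha> (n \<otimes>\<^bsub>M\<^esub> m)) \<inter> dom (\<alpha> m)"
    and c: "\<And>x. x \<in> dom (\<alpha> n \<circ>\<^sub>m \<alpha> m) \<Longrightarrow> (\<alpha> n \<circ>\<^sub>m \<alpha> m) x = \<alpha> (n \<otimes>\<^bsub>M\<^esub> m) x"
    using strong assms(1,2) unfolding strong_partial_action_def by blast+
  show ?thesis
  proof (cases "\<alpha> n y")
    case None
    then have "x \<notin> dom (\<alpha> n \<circ>\<^sub>m \<alpha> m)" using e by (simp add: domIff)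
    \<comment> \<open>Strength of the action is used here: \<open>x\<close> lies in
      \<open>dom (\<alpha> m)\<close>, so the domain equation forbids that the product acts on
      \<open>x\<close> when \<open>n\<close> does not act on \<open>y\<close>.\<close>
    then have "x \<notin> dom (\<alpha> (n \<otimes>\<^bsub>M\<^esub> m))" using d assms(3) by blast
    then show ?thesis using None by (simp add: domIff)
  next
    case (Some z)
    then have "x \<in> dom (\<alpha> n \<circ>\<^sub>m \<alpha> m)" using e by (simp add: domIff)
    then show ?thesis using c e by metis
  qed
qed

abbreviation cls :: "'m \<Rightarrow> 'x \<Rightarrow> ('m \<times> 'x) set" where
  "cls \<equiv> tensor_class M X \<alpha>"

abbreviation T :: "('m \<times> 'x) set set" where
  "T \<equiv> tensor_set M X \<alpha>"

lemma cls_mem_iff: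
  assumes "m \<in> carrier M" "x \<in> carrier X"
  shows "(n, y) \<in> cls m x \<longleftrightarrow>
    n \<in> carrier M \<and> y \<in> carrier X \<and> equivclp (tensor_step M X \<alpha>) (m, x) (n, y)"
  using assms unfolding tensor_class_def tensor_rel_def by auto

lemma cls_self: "\<lbrakk>m \<in> carrier M; x \<in> carrier X\<rbrakk> \<Longrightarrow> (m, x) \<in> cls m x"
  by (simp add: cls_mem_iff)

lemma cls_eqI:
  assumes "m \<in> carrier M" "x \<in> carrier X" "n \<in> carrier M" "y \<in> carrier X"
    and "equivclp (tensor_step M X \<alpha>) (m, x) (n, y)"
  shows "cls m x = cls n y"
proof (rule Set.set_eqI)
  fix p :: "'m \<times> 'x"
  obtain a b where "p = (a, b)" by (cases p)
  then show "p \<in> cls m x \<longleftrightarrow> p \<in> cls n y"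
    using assms by (meson cls_mem_iff equivclp_trans equivclp_sym)
qed

text \<open>The balancing relation of the tensor product. With \<open>m\<close> the identity it
  makes \<iota> compatible with the actions.\<close>

lemma cls_mult:
  assumes "m \<in> carrier M" "k \<in> carrier M" "\<alpha> k x = Some y"
  shows "cls (m \<otimes>\<^bsub>M\<^esub> k) x = cls m y"
proof (rule cls_eqI)
  have "tensor_step M X \<alpha> (m \<otimes>\<^bsub>M\<^esub> k, x) (m, y)"
    using assms action_closed[OF assms(2,3)] unfolding tensor_step_def by (simp add: domIff) blast
  then show "equivclp (tensor_step M X \<alpha>) (m \<otimes>\<^bsub>M\<^esub> k, x) (m, y)" by blast
qed (simp_all add: assms action_closed[OF assms(2,3)])

lemma T_eq: "T = (\<lambda>(m, x). cls m x) ` (carrier M \<times> carrier X)"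
  by (simp add: tensor_set_def tensor_class_def quotient_def UNION_singleton_eq_range case_prod_beta')

lemma cls_in_T: "\<lbrakk>m \<in> carrier M; x \<in> carrier X\<rbrakk> \<Longrightarrow> cls m x \<in> T"
  by (auto simp: T_eq)

lemma T_cases:
  assumes "c \<in> T"
  obtains m x where "c = cls m x" "m \<in> carrier M" "x \<in> carrier X"
  using assms by (auto simp: T_eq)

text \<open>A generating step turns \<open>(n k, x)\<close> into \<open>(n, y)\<close> with
  \<open>\<alpha> k x = Some y\<close>, and \<open>action_comp\<close> equates the two partial
  values. Comparing options keeps track of definedness as well as of values.\<close>

lemma equivclp_action_eq:
  assumes "equivclp (tensor_step M X \<alpha>) p q"
  shows "\<alpha> (fst p) (snd p) = \<alpha> (fst q) (snd q)"
  using assms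
proof induction
  case (step q r)
  have "\<alpha> (fst p) (snd p) = \<alpha> (fst q) (snd q)" if "tensor_step M X \<alpha> p q" for p q
    using that unfolding tensor_step_def by (cases p, cases q) (clarsimp, rule action_comp)
  then show ?case using step by metis
qed simp

lemma cls_eq_action_eq:
  assumes "m \<in> carrier M" "x \<in> carrier X" "n \<in> carrier M" "y \<in> carrier X" "cls m x = cls n y"
  shows "\<alpha> m x = \<alpha> n y"
proof -
  have "(n, y) \<in> cls m x" using cls_self[OF assms(3,4)] assms(5) by simp
  then show ?thesis using equivclp_action_eq[of "(m, x)" "(n, y)"] assms(1,2) by (simp add: cls_mem_iff)
qed

text \<open>The union over all representatives avoids a choice; by \<open>act_cls\<close> all its
  members coincide when \<open>c\<close> is a class.\<close>

definition act :: "'m \<Rightarrow> ('m \<times> 'x) set \<Rightarrow> ('m \<times> 'x) set" where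
  "act k c = (\<Union>(m, x)\<in>c. cls (k \<otimes>\<^bsub>M\<^esub> m) x)"

text \<open>By associativity, multiplying first coordinates by \<open>k\<close> on the left
  preserves generating steps, so all sets in the union are equal; the pair \<open>(m, x)\<close>
  itself contributes one.\<close>

lemma act_cls:
  assumes "k \<in> carrier M" "m \<in> carrier M" "x \<in> carrier X"
  shows "act k (cls m x) = cls (k \<otimes>\<^bsub>M\<^esub> m) x"
proof -
  have "cls (k \<otimes>\<^bsub>M\<^esub> n) y = cls (k \<otimes>\<^bsub>M\<^esub> m) x" if "(n, y) \<in> cls m x" for n y
  proof -
    have ny: "n \<in> carrier M" "y \<in> carrier X" "equivclp (tensor_step M X \<alpha>) (m, x) (n, y)"
      using that assms by (auto simp: cls_mem_iff)
    have "tensor_step M X \<alpha> (k \<otimes>\<^bsub>M\<^esub> fst p, snd p) (k \<otimes>\<^bsub>M\<^esub> fst q, snd q)"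
      if "tensor_step M X \<alpha> p q" for p q
    proof -
      obtain l y n z where *: "p = (n \<otimes>\<^bsub>M\<^esub> l, y)" "q = (n, z)" "n \<in> carrier M" "l \<in> carrier M"
        "y \<in> carrier X" "z \<in> carrier X" "y \<in> dom (\<alpha> l)" "\<alpha> l y = Some z"
        using \<open>tensor_step M X \<alpha> p q\<close> unfolding tensor_step_def by blast
      then have "k \<otimes>\<^bsub>M\<^esub> (n \<otimes>\<^bsub>M\<^esub> l) = (k \<otimes>\<^bsub>M\<^esub> n) \<otimes>\<^bsub>M\<^esub> l"
        using assms(1) by (simp add: M.m_assoc)
      then show ?thesis using * assms(1) unfolding tensor_step_def by auto
    qed
    from equivclp_map[where r = "tensor_step M X \<alpha>" and s = "tensor_step M X \<alpha>"
        and f = "\<lambda>p. (k \<otimes>\<^bsub>M\<^esub> fst p, snd p)", OF this ny(3)]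
    have "equivclp (tensor_step M X \<alpha>) (k \<otimes>\<^bsub>M\<^esub> m, x) (k \<otimes>\<^bsub>M\<^esub> n, y)" by simp
    then show ?thesis using assms ny by (intro cls_eqI) (auto intro: equivclp_sym)
  qed
  then show ?thesis using cls_self[OF assms(2,3)] unfolding act_def by fast
qed

lemma act_in_T: "\<lbrakk>k \<in> carrier M; c \<in> T\<rbrakk> \<Longrightarrow> act k c \<in> T"
  by (elim T_cases) (simp add: act_cls cls_in_T)

lemma act_one: "c \<in> T \<Longrightarrow> act \<one>\<^bsub>M\<^esub> c = c"
  by (elim T_cases) (simp add: act_cls)

lemma act_act: "\<lbrakk>k \<in> carrier M; l \<in> carrier M; c \<in> T\<rbrakk> \<Longrightarrow> act l (act k c) = act (l \<otimes>\<^bsub>M\<^esub> k) c"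
  by (elim T_cases) (simp add: act_cls M.m_assoc)

subsection \<open>The semigroup of words modulo rewriting\<close>

abbreviation W :: "('m \<times> 'x) set list set" where
  "W \<equiv> tensor_words M X \<alpha>"

abbreviation red :: "('m \<times> 'x) set list \<Rightarrow> ('m \<times> 'x) set list \<Rightarrow> bool" where
  "red \<equiv> word_step M X \<alpha>"

lemma W_append: "\<lbrakk>u \<in> W; v \<in> W\<rbrakk> \<Longrightarrow> u @ v \<in> W"
  by (auto simp: tensor_words_def)

lemma W_map_act: "\<lbrakk>k \<in> carrier M; w \<in> W\<rbrakk> \<Longrightarrow> map (act k) w \<in> W"
  by (auto simp: tensor_words_def act_in_T)

lemma W_single: "\<lbrakk>m \<in> carrier M; x \<in> carrier X\<rbrakk> \<Longrightarrow> [cls m x] \<in> W"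
  by (simp add: tensor_words_def cls_in_T)

lemma word_step_in_W: "red w w' \<Longrightarrow> w \<in> W"
  unfolding word_step_def tensor_words_def by (auto simp: cls_in_T)

lemma word_step_length: "red w w' \<Longrightarrow> length w' < length w"
  unfolding word_step_def by auto

lemma word_step_single: "\<not> red [c] w"
  unfolding word_step_def by (auto simp: Cons_eq_append_conv)

text \<open>The two letters of a redex are represented with the same \<open>m\<close>, hence their
  images with the same product of \<open>k\<close> and \<open>m\<close>, while \<open>x\<close> and
  \<open>y\<close> stay.\<close>

lemma word_step_map_act:
  assumes "red w w'" "k \<in> carrier M"
  shows "red (map (act k) w) (map (act k) w')"
proof -
  obtain u v m x y where *: "u \<in> lists T" "v \<in> lists T" "m \<in> carrier M" "x \<in> carrier X" "y \<in> carrier X"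
    "w = u @ [cls m x, cls m y] @ v" "w' = u @ [cls m (x \<otimes>\<^bsub>X\<^esub> y)] @ v"
    using assms(1) unfolding word_step_def by blast
  have "map (act k) u \<in> lists T" "map (act k) v \<in> lists T" "k \<otimes>\<^bsub>M\<^esub> m \<in> carrier M"
    "map (act k) w = map (act k) u @ [cls (k \<otimes>\<^bsub>M\<^esub> m) x, cls (k \<otimes>\<^bsub>M\<^esub> m) y] @ map (act k) v"
    "map (act k) w' = map (act k) u @ [cls (k \<otimes>\<^bsub>M\<^esub> m) (x \<otimes>\<^bsub>X\<^esub> y)] @ map (act k) v"
    using * assms(2) by (auto simp: act_cls act_in_T X.m_closed)
  then show ?thesis using *(4,5) unfolding word_step_def by blast
qed

text \<open>The context of a redex absorbs the added word. This makes the generated equivalence a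
  congruence.\<close>

lemma word_step_append:
  assumes "red w w'" "a \<in> W" "b \<in> W"
  shows "red (a @ w) (a @ w')" "red (w @ b) (w' @ b)"
proof -
  obtain u v m x y where *: "u \<in> lists T" "v \<in> lists T" "m \<in> carrier M" "x \<in> carrier X" "y \<in> carrier X"
    "w = u @ [cls m x, cls m y] @ v" "w' = u @ [cls m (x \<otimes>\<^bsub>X\<^esub> y)] @ v"
    using assms(1) unfolding word_step_def by blast
  have "a @ u \<in> lists T" "a @ w = (a @ u) @ [cls m x, cls m y] @ v"
    "a @ w' = (a @ u) @ [cls m (x \<otimes>\<^bsub>X\<^esub> y)] @ v"
    using * assms(2) by (auto simp: tensor_words_def)
  then show "red (a @ w) (a @ w')" using *(2-5) unfolding word_step_def by blast
  have "v @ b \<in> lists T" "w @ b = u @ [cls m x, cls m y] @ (v @ b)"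
    "w' @ b = u @ [cls m (x \<otimes>\<^bsub>X\<^esub> y)] @ (v @ b)"
    using * assms(3) by (auto simp: tensor_words_def)
  then show "red (w @ b) (w' @ b)" using *(1,3-5) unfolding word_step_def by blast
qed

definition wcls :: "('m \<times> 'x) set list \<Rightarrow> ('m \<times> 'x) set list set" where
  "wcls w = Collect (equivclp red w)"

definition rep :: "('m \<times> 'x) set list set \<Rightarrow> ('m \<times> 'x) set list" where
  "rep p = (SOME w. w \<in> W \<and> wcls w = p)"

text \<open>The quotient of the free semigroup on \<open>T\<close> by the congruence generated by
  \<open>red\<close>; \<open>one\<close> is a mere filler.\<close>

definition word_semigrp :: "('m \<times> 'x) set list set monoid" where
  "word_semigrp =
    \<lparr>carrier = wcls ` W, mult = (\<lambda>p q. wcls (rep p @ rep q)), one = undefined\<rparr>"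

definition word_act :: "'m \<Rightarrow> ('m \<times> 'x) set list set \<Rightarrow> ('m \<times> 'x) set list set" where
  "word_act k p = wcls (map (act k) (rep p))"

lemma wcls_eq_iff: "wcls u = wcls v \<longleftrightarrow> equivclp red u v"
  unfolding wcls_def set_eq_iff mem_Collect_eq
  by (meson equivclp_refl equivclp_sym equivclp_trans)

lemma rep_wcls:
  assumes "w \<in> W"
  shows "rep (wcls w) \<in> W" "equivclp red (rep (wcls w)) w"
proof -
  have "rep (wcls w) \<in> W \<and> wcls (rep (wcls w)) = wcls w"
    unfolding rep_def by (rule someI[where x = w]) (simp add: assms)
  then show "rep (wcls w) \<in> W" "equivclp red (rep (wcls w)) w" by (auto simp: wcls_eq_iff)
qed

lemma word_semigrp_carrier: "carrier word_semigrp = wcls ` W"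
  by (simp add: word_semigrp_def)

text \<open>The chosen representatives are replaced one factor at a time, first the left, then the
  right.\<close>

lemma word_semigrp_mult:
  assumes "u \<in> W" "v \<in> W"
  shows "wcls u \<otimes>\<^bsub>word_semigrp\<^esub> wcls v = wcls (u @ v)"
proof -
  have "equivclp red (rep (wcls u) @ rep (wcls v)) (u @ rep (wcls v))"
    using equivclp_map[where f = "\<lambda>w. w @ rep (wcls v)"] word_step_append(2) rep_wcls assms by metis
  moreover have "equivclp red (u @ rep (wcls v)) (u @ v)"
    using equivclp_map[where f = "\<lambda>w. u @ w"] word_step_append(1) rep_wcls assms by metis
  ultimately show ?thesis
    by (simp add: word_semigrp_def wcls_eq_iff) (rule equivclp_trans)
qed

lemma word_act_wcls:
  assumes "k \<in> carrier M" "w \<in> W"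
  shows "word_act k (wcls w) = wcls (map (act k) w)"
  unfolding word_act_def wcls_eq_iff
  by (rule equivclp_map[where r = red]) (use assms rep_wcls word_step_map_act in auto)

lemma word_semigrp: "semigrp word_semigrp"
  by standard (auto simp: word_semigrp_carrier word_semigrp_mult W_append)

lemma word_action:
  "global_action_semigrp M word_semigrp
    (\<lambda>m p. if p \<in> carrier word_semigrp then Some (word_act m p) else None)"
proof (rule global_action_semigrpI[OF M.monoid_axioms word_semigrp])
  fix p assume "p \<in> carrier word_semigrp"
  then obtain w where w: "w \<in> W" "p = wcls w" by (auto simp: word_semigrp_carrier)
  have "map (act \<one>\<^bsub>M\<^esub>) w = w"
    using w(1) by (auto simp: tensor_words_def act_one intro!: map_idI)
  then show "word_act \<one>\<^bsub>M\<^esub> p = p" using w by (simp add: word_act_wcls)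
next
  fix m n p assume mn: "m \<in> carrier M" "n \<in> carrier M" and "p \<in> carrier word_semigrp"
  then obtain w where w: "w \<in> W" "p = wcls w" by (auto simp: word_semigrp_carrier)
  have "map (act n) (map (act m) w) = map (act (n \<otimes>\<^bsub>M\<^esub> m)) w"
    using w(1) mn by (auto simp: tensor_words_def act_act)
  \<comment> \<open>The maps are kept nested so that the preceding equation can rewrite
    them.\<close>
  then show "word_act n (word_act m p) = word_act (n \<otimes>\<^bsub>M\<^esub> m) p"
    using mn w W_map_act by (simp add: word_act_wcls del: map_map)
qed (auto simp: word_semigrp_carrier word_semigrp_mult word_act_wcls W_append W_map_act)

section \<open>Confluence and the globalization\<close>

lemma word_step_confluent:
  assumes "locally_confluent_on W red"
  shows "confluentp red"
proof (rule newman)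
  \<comment> \<open>Termination: each step replaces two letters by one.\<close>
  show "wfp red\<inverse>\<inverse>"
    by (rule wfp_if_convertible_to_nat[where f = length]) (auto dest: word_step_length)
  \<comment> \<open>A list outside \<open>W\<close> admits no step, so it is locally confluent
    vacuously.\<close>
  show "locally_confluent_at red w" for w
    using assms word_step_in_W unfolding locally_confluent_on_def locally_confluent_at_def by blast
qed

lemma globalizable_if_locally_confluent:
  assumes "locally_confluent_on W red"
  shows "globalizable M X \<alpha>"
proof -
  define \<iota> where "\<iota> x = wcls [cls \<one>\<^bsub>M\<^esub> x]" for x
  define \<beta> where
    "\<beta> m p = (if p \<in> carrier word_semigrp then Some (word_act m p) else None)" for m p
  have \<iota>: "\<iota> x \<in> carrier word_semigrp" if "x \<in> carrier X" for x
    using that by (auto simp: \<iota>_def word_semigrp_carrier W_single)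
  \<comment> \<open>Membership in the carrier is settled before \<iota> is unfolded; acting by
    \<open>m\<close> on the class of the identity and \<open>x\<close> then gives
    \<open>cls m x\<close>.\<close>
  have act_\<iota>: "\<beta> m (\<iota> x) = Some (wcls [cls m x])" if "m \<in> carrier M" "x \<in> carrier X" for m x
    using that \<iota>[OF that(2)] by (simp add: \<beta>_def) (simp add: \<iota>_def word_act_wcls W_single act_cls)
  have "\<iota> (x \<otimes>\<^bsub>X\<^esub> y) = \<iota> x \<otimes>\<^bsub>word_semigrp\<^esub> \<iota> y"
    if "x \<in> carrier X" "y \<in> carrier X" for x y
  proof -
    have "red ([] @ [cls \<one>\<^bsub>M\<^esub> x, cls \<one>\<^bsub>M\<^esub> y] @ []) ([] @ [cls \<one>\<^bsub>M\<^esub> (x \<otimes>\<^bsub>X\<^esub> y)] @ [])"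
      unfolding word_step_def using that by blast
    then show ?thesis
      using that by (auto simp: \<iota>_def word_semigrp_mult W_single wcls_eq_iff)
  qed
  then have hom: "\<iota> \<in> hom X word_semigrp" using \<iota> by (auto simp: hom_def)
  have mor: "\<beta> m (\<iota> x) = Some (\<iota> (the (\<alpha> m x)))" if "m \<in> carrier M" "x \<in> dom (\<alpha> m)" for m x
  proof -
    obtain y where y: "\<alpha> m x = Some y" using \<open>x \<in> dom (\<alpha> m)\<close> by blast
    \<comment> \<open>Multiplying by the identity on the left puts \<open>cls m x\<close> in the
      form required by \<open>cls_mult\<close>, which turns it into the letter of
      \<open>\<iota> y\<close>.\<close>
    show ?thesis
      using act_\<iota>[OF that(1) action_closed(1)[OF that(1) y]] cls_mult[OF M.one_closed that(1) y] that(1) y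
      by (simp add: \<iota>_def)
  qed
  have refl: "\<alpha> m x = Some y"
    if "x \<in> carrier X" "y \<in> carrier X" "m \<in> carrier M" "\<beta> m (\<iota> x) = Some (\<iota> y)" for x y m
  proof -
    have "equivclp red [cls m x] [cls \<one>\<^bsub>M\<^esub> y]"
      using that act_\<iota> by (simp add: \<iota>_def wcls_eq_iff)
    \<comment> \<open>Irreducibility of one-letter words turns equivalence into equality of the
      letters, on which the partial value depends alone.\<close>
    from equivclp_irreducible_eq[OF word_step_confluent[OF assms] this word_step_single word_step_single]
    have "\<alpha> m x = \<alpha> \<one>\<^bsub>M\<^esub> y" using that by (intro cls_eq_action_eq) auto
    then show ?thesis using that(2) by (simp add: action_one)
  qed
  have "globalization M X \<alpha> word_semigrp \<beta> \<iota>"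
    using word_semigrp word_action hom mor refl
    unfolding globalization_def action_morphism_def \<beta>_def[abs_def] by blast
  then show ?thesis unfolding globalizable_def by blast
qed

end

theorem corollary2p12:
  fixes M :: "('m, 'k) monoid_scheme" and X :: "('x, 'l) monoid_scheme"
    and \<alpha> :: "'m \<Rightarrow> 'x \<rightharpoonup> 'x"
  assumes "monoid M" and "semigrp X"
    and "strong_partial_action_semigrp M X \<alpha>"
    and "locally_confluent_on (tensor_words M X \<alpha>) (word_step M X \<alpha>)"
  shows "globalizable M X \<alpha>"
proof -
  interpret semigrp_partial_action M X \<alpha>
    using assms(1-3) by (simp add: semigrp_partial_action_def semigrp_partial_action_axioms_def)
  show ?thesis using assms(4) by (rule globalizable_if_locally_confluent)
qed

end
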